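(* Let $\beta^{(3)}=\{\beta_{ij}\}_{i,j\ge 0,\ i+j\le 3}$ be a nonsingular cubic binary moment sequence, let $a_0,a_1,a_2,a_3$ be the cubic moments of its normalization, and let $$k:=(1+a_0a_2+a_1a_3)-(a_1^2+a_2^2).$$ Assume that $k\neq 0$. Then $\beta^{(3)}$ admits a $4$-atomic representing measure; that is, there exist four distinct points $(x_1,y_1),\dots,(x_4,y_4)\in\mathbb{R}^2$ and real numbers $\rho_1,\dots,\rho_4>0$ such that $\beta_{ij}=\sum_{l=1}^{4}\rho_l\,x_l^i y_l^j$ for all integers $i,j\ge 0$ with $i+j\le 3$.
   Context: A cubic binary (real) moment sequence is a finite family of real numbers $\beta^{(3)}=\{\beta_{00},\beta_{10},\beta_{01},\beta_{20},\beta_{11},\beta_{02},\beta_{30},\beta_{21},\beta_{12},\beta_{03}\}$ with $\beta_{00}>0$ (no measure is assumed to exist). It is called nonsingular if the $3\times 3$ matrix $$\mathcal{M}(1)=\begin{pmatrix}\beta_{00}&\beta_{10}&\beta_{01}\\ \beta_{10}&\beta_{20}&\beta_{11}\\ \beta_{01}&\beta_{11}&\beta_{02}\end{pmatrix}$$ is positive definite. A representing measure for $\beta^{(3)}$ is a positive Borel measure $\mu$ on $\mathbb{R}^2$ such that $\beta_{ij}=\int x^iy^j\,d\mu$ for all $i,j\ge 0$ with $i+j\le 3$. It is $r$-atomic if its support consists of exactly $r$ points. Normalization: first, dividing all $\beta_{ij}$ by $\beta_{00}$, assume $\beta_{00}=1$. Put $d_2:=\beta_{20}-\beta_{10}^2$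 and $d_3:=\det\mathcal{M}(1)=-\beta_{02}\beta_{10}^2+2\beta_{01}\beta_{10}\beta_{11}-\beta_{11}^2-\beta_{01}^2\beta_{20}+\beta_{02}\beta_{20}$, both strictly positive by nonsingularity. Let $$\Psi_1(x,y):=\frac{\beta_{01}\beta_{20}-\beta_{10}\beta_{11}}{\sqrt{d_2d_3}}+\frac{\beta_{11}-\beta_{01}\beta_{10}}{\sqrt{d_2d_3}}\,x-\sqrt{\frac{d_2}{d_3}}\,y,\qquad \Psi_2(x,y):=-\frac{\beta_{10}}{\sqrt{d_2}}+\frac{1}{\sqrt{d_2}}\,x .$$ Let $\Lambda_\beta$ be the Riesz functional, i.e. the linear functional on real polynomials in $x,y$ of degree at most $3$ with $\Lambda_\beta(x^iy^j)=\beta_{ij}$, and define $\tilde\beta_{ij}:=\Lambda_\beta(\Psi_1^i\Psi_2^j)$ for $i+j\le 3$. Then $\tilde\beta_{00}=\tilde\beta_{20}=\tilde\beta_{02}=1$ and $\tilde\beta_{10}=\tilde\beta_{01}=\tilde\beta_{11}=0$, so that $\tilde\beta=\{1,0,0,1,0,1,a_0,a_1,a_2,a_3\}$ where $a_i:=\tilde\beta_{3-i,i}$ for $i=0,1,2,3$. The sequence $\tilde\beta$ is the normalization of $\beta^{(3)}$, and $a_0,\dots,a_3$ are its cubic moments. *)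

theory Defs
  imports "HOL-Analysis.Analysis" "HOL-Computational_Algebra.Polynomial"
begin

(* A cubic binary sequence is a function \<beta> :: nat \<Rightarrow> nat \<Rightarrow> real of which only the values
   \<beta> i j with i + j \<le> 3 are ever used; the other values are irrelevant. *)

definition moment_matrix1 :: "(nat \<Rightarrow> nat \<Rightarrow> real) \<Rightarrow> real ^ 3 ^ 3" where
  "moment_matrix1 \<beta> = vector
     [vector [\<beta> 0 0, \<beta> 1 0, \<beta> 0 1],
      vector [\<beta> 1 0, \<beta> 2 0, \<beta> 1 1],
      vector [\<beta> 0 1, \<beta> 1 1, \<beta> 0 2]]"

definition positive_definite :: "real ^ 'n ^ 'n \<Rightarrow> bool" where
  "positive_definite A \<longleftrightarrow> transpose A = A \<and> (\<forall>v. v \<noteq> 0 \<longrightarrow> v \<bullet> (A *v v) > 0)"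

definition cubic_moment_sequence :: "(nat \<Rightarrow> nat \<Rightarrow> real) \<Rightarrow> bool" where
  "cubic_moment_sequence \<beta> \<longleftrightarrow> \<beta> 0 0 > 0"

definition nonsingular :: "(nat \<Rightarrow> nat \<Rightarrow> real) \<Rightarrow> bool" where
  "nonsingular \<beta> \<longleftrightarrow> positive_definite (moment_matrix1 \<beta>)"

(* Bivariate polynomials are polynomials in y whose coefficients are polynomials in x:
   the coefficient of x^i y^j in p is coeff (coeff p j) i. *)

type_synonym bipoly = "real poly poly"

definition X :: bipoly where "X = [:[:0, 1:]:]"

definition Y :: bipoly where "Y = [:0, 1:]"

definition const :: "real \<Rightarrow> bipoly" where "const c = [:[:c:]:]"

(* Meant for polynomials of total degree at most 3; terms of higher degree are ignored. *)
definition riesz :: "(nat \<Rightarrow> nat \<Rightarrow> real) \<Rightarrow> bipoly \<Rightarrow> real" where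
  "riesz \<beta> p = (\<Sum>(i, j) \<in> {(i, j). i + j \<le> 3}. coeff (coeff p j) i * \<beta> i j)"

definition d2 :: "(nat \<Rightarrow> nat \<Rightarrow> real) \<Rightarrow> real" where
  "d2 \<beta> = \<beta> 2 0 - (\<beta> 1 0)\<^sup>2"

definition d3 :: "(nat \<Rightarrow> nat \<Rightarrow> real) \<Rightarrow> real" where
  "d3 \<beta> = det (moment_matrix1 \<beta>)"

definition Psi1 :: "(nat \<Rightarrow> nat \<Rightarrow> real) \<Rightarrow> bipoly" where
  "Psi1 \<beta> =
     const ((\<beta> 0 1 * \<beta> 2 0 - \<beta> 1 0 * \<beta> 1 1) / sqrt (d2 \<beta> * d3 \<beta>))
     + const ((\<beta> 1 1 - \<beta> 0 1 * \<beta> 1 0) / sqrt (d2 \<beta> * d3 \<beta>)) * X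
     - const (sqrt (d2 \<beta> / d3 \<beta>)) * Y"

definition Psi2 :: "(nat \<Rightarrow> nat \<Rightarrow> real) \<Rightarrow> bipoly" where
  "Psi2 \<beta> = const (- \<beta> 1 0 / sqrt (d2 \<beta>)) + const (1 / sqrt (d2 \<beta>)) * X"

(* d2, d3, Psi1 and Psi2 presuppose \<beta> 0 0 = 1, hence they are applied to \<beta> / \<beta> 0 0. *)
definition normalization :: "(nat \<Rightarrow> nat \<Rightarrow> real) \<Rightarrow> nat \<Rightarrow> nat \<Rightarrow> real" where
  "normalization \<beta> i j =
     (let \<gamma> = (\<lambda>i j. \<beta> i j / \<beta> 0 0) in riesz \<gamma> (Psi1 \<gamma> ^ i * Psi2 \<gamma> ^ j))"

definition cubic_moment :: "(nat \<Rightarrow> nat \<Rightarrow> real) \<Rightarrow> nat \<Rightarrow> real" where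
  "cubic_moment \<beta> i = normalization \<beta> (3 - i) i"

(* Integrability is required explicitly because the Bochner integral of a non-integrable
   function is 0 by convention. *)
definition representing_measure ::
  "(nat \<Rightarrow> nat \<Rightarrow> real) \<Rightarrow> (real \<times> real) measure \<Rightarrow> bool" where
  "representing_measure \<beta> \<mu> \<longleftrightarrow> sets \<mu> = sets borel \<and>
     (\<forall>i j. i + j \<le> 3 \<longrightarrow>
        integrable \<mu> (\<lambda>(x, y). x ^ i * y ^ j) \<and> \<beta> i j = (\<integral>(x, y). x ^ i * y ^ j \<partial>\<mu>))"

definition measure_support :: "'a::topological_space measure \<Rightarrow> 'a set" where
  "measure_support \<mu> = {z. \<forall>U. open U \<and> z \<in> U \<longrightarrow> emeasure \<mu> U > 0}"

definition atomic :: "nat \<Rightarrow> 'a::topological_space measure \<Rightarrow> bool" where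
  "atomic r \<mu> \<longleftrightarrow> finite (measure_support \<mu>) \<and> card (measure_support \<mu>) = r"

end

theory Submission
  imports Defs
begin

text \<open>For the normalized sequence, multiplication by \<open>x\<close> and \<open>y\<close>, compressed to the
  orthonormal system \<open>1, x, y\<close>, gives two symmetric \<open>3 \<times> 3\<close> matrices determined by the cubic
  moments, and \<open>k\<close> is the only independent entry of their commutator. If \<open>k \<noteq> 0\<close>, the matrices can
  be bordered to commuting symmetric \<open>4 \<times> 4\<close> matrices without changing the moments of degree at
  most \<open>3\<close>. Their joint eigenvalues are the atoms, and the weights are the squared coordinates of
  the first basis vector in a joint orthonormal eigenbasis; that vector is cyclic, so the four
  atoms are distinct and the weights positive. Inverting \<open>(\<Psi>\<^sub>1, \<Psi>\<^sub>2)\<close> carries the atoms back.\<close>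

section \<open>Joint diagonalization of commuting self-adjoint maps\<close>

text \<open>A maximizer \<open>v\<close> of the Rayleigh quotient on the compact unit sphere of
  \<open>V\<close> is an eigenvector: otherwise moving from \<open>v\<close> along the residual
  \<open>c *\<^sub>R v - f v\<close>, which lies in \<open>V\<close> by invariance, would violate
  maximality.\<close>

lemma self_adjoint_eigenvector:
  fixes f :: "'a::euclidean_space \<Rightarrow> 'a"
  assumes "linear f" and sa: "\<And>x y. f x \<bullet> y = x \<bullet> f y"
    and V: "subspace V" "V \<noteq> {0}" and inv: "f ` V \<subseteq> V"
  obtains v c where "v \<in> V" "norm v = 1" "f v = c *\<^sub>R v"
proof -
  interpret linear f by fact
  obtain u where u: "u \<in> V" "u \<noteq> 0"
    using V subspace_0 by blast
  let ?K = "sphere 0 1 \<inter> V"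
  have "(1 / norm u) *\<^sub>R u \<in> ?K"
    using u V by (simp add: subspace_scale)
  moreover have "compact ?K"
    using V by (simp add: closed_subspace compact_Int_closed)
  moreover have "continuous_on ?K (\<lambda>x. x \<bullet> f x)"
    using linear_continuous_on[of f ?K] \<open>linear f\<close> linear_conv_bounded_linear
    by (auto intro!: continuous_intros)
  ultimately obtain v where v: "v \<in> ?K" and max: "\<And>x. x \<in> ?K \<Longrightarrow> x \<bullet> f x \<le> v \<bullet> f v"
    using continuous_attains_sup[of ?K "\<lambda>x. x \<bullet> f x"] by blast
  define c where "c = v \<bullet> f v"
  have vv: "v \<bullet> v = 1"
    using v by (simp add: dot_square_norm)
  have ge: "x \<bullet> f x \<le> c * (x \<bullet> x)" if "x \<in> V" for x
  proof (cases "x = 0")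
    case True
    then show ?thesis by simp
  next
    case False
    let ?y = "(1 / norm x) *\<^sub>R x"
    have "?y \<bullet> f ?y \<le> c"
      unfolding c_def using False that V by (intro max) (simp add: subspace_scale)
    then have "(x \<bullet> f x) / (norm x)\<^sup>2 \<le> c"
      by (simp add: scale power2_eq_square)
    then show ?thesis
      using False by (simp add: divide_le_eq power2_norm_eq_inner)
  qed
  define h where "h = c *\<^sub>R v - f v"
  have hV: "h \<in> V"
    unfolding h_def using v inv V by (auto intro!: subspace_diff subspace_scale)
  define q where "q = c * (h \<bullet> h) - h \<bullet> f h"
  have q: "q \<ge> 0"
    unfolding q_def using ge[OF hV] by simp
  \<comment> \<open>This is \<open>ge\<close> at \<open>v + t *\<^sub>R h\<close>. A quadratic in
    \<open>t\<close> that vanishes at 0 and is never negative has no linear term, so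
    \<open>h\<close> must vanish.\<close>
  have quad: "0 \<le> 2 * t * (h \<bullet> h) + t\<^sup>2 * q" for t
  proof -
    have "v + t *\<^sub>R h \<in> V"
      using v hV V by (auto intro!: subspace_add subspace_scale)
    from ge[OF this] have "(v + t *\<^sub>R h) \<bullet> f (v + t *\<^sub>R h)
        \<le> c * ((v + t *\<^sub>R h) \<bullet> (v + t *\<^sub>R h))" .
    moreover have "(v + t *\<^sub>R h) \<bullet> f (v + t *\<^sub>R h) =
        c + 2 * t * (h \<bullet> f v) + t\<^sup>2 * (h \<bullet> f h)"
      using sa[of v h]
      by (simp add: add scale c_def inner_add_left inner_add_right inner_commute[of "f v"]
          power2_eq_square algebra_simps)
    moreover have "(v + t *\<^sub>R h) \<bullet> (v + t *\<^sub>R h) = 1 + 2 * t * (h \<bullet> v) + t\<^sup>2 * (h \<bullet> h)"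
      using vv by (simp add: algebra_simps inner_commute power2_eq_square)
    moreover have "c * (h \<bullet> v) = h \<bullet> h + h \<bullet> f v"
      by (subst (2) h_def) (simp add: inner_diff_right)
    then have "c * (1 + 2 * t * (h \<bullet> v) + t\<^sup>2 * (h \<bullet> h)) =
        c + 2 * t * (h \<bullet> h + h \<bullet> f v) + c * t\<^sup>2 * (h \<bullet> h)"
      by (simp add: distrib_left mult.left_commute[of c] mult.assoc)
    ultimately show ?thesis
      by (simp add: q_def distrib_left right_diff_distrib mult_ac)
  qed
  have "h \<bullet> h = 0"
  proof (rule ccontr)
    assume "h \<bullet> h \<noteq> 0"
    then have pos: "h \<bullet> h > 0"
      using inner_ge_zero[of h] by linarith
    \<comment> \<open>The denominator \<open>1 + q\<close> instead of \<open>q\<close> also covers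
      \<open>q = 0\<close> and still makes the quadratic negative.\<close>
    define t where "t = - (h \<bullet> h) / (1 + q)"
    have t: "t * (1 + q) = - (h \<bullet> h)"
      using q by (simp add: t_def)
    have "t < 0"
      using pos q by (simp add: t_def divide_neg_pos)
    have "2 * t * (h \<bullet> h) + t\<^sup>2 * q = t * (h \<bullet> h) - t\<^sup>2"
      using arg_cong[OF t, of "\<lambda>s. t * s"] by (simp add: algebra_simps power2_eq_square)
    also have "\<dots> < 0"
      using pos \<open>t < 0\<close> by (simp add: mult_neg_pos add_neg_neg flip: add_uminus_conv_diff)
    finally show False
      using quad[of t] by simp
  qed
  then have "f v = c *\<^sub>R v"
    by (simp add: h_def)
  with v show thesis
    by (intro that) auto
qed

text \<open>An eigenspace of \<open>f\<close> is invariant under \<open>g\<close> because the maps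
  commute, so \<open>g\<close> has an eigenvector inside it.\<close>

lemma commuting_self_adjoint_eigenvector:
  fixes f g :: "'a::euclidean_space \<Rightarrow> 'a"
  assumes f: "linear f" "\<And>x y. f x \<bullet> y = x \<bullet> f y"
    and g: "linear g" "\<And>x y. g x \<bullet> y = x \<bullet> g y"
    and comm: "\<And>x. f (g x) = g (f x)"
    and V: "subspace V" "V \<noteq> {0}" "f ` V \<subseteq> V" "g ` V \<subseteq> V"
  obtains v a b where "v \<in> V" "norm v = 1" "f v = a *\<^sub>R v" "g v = b *\<^sub>R v"
proof -
  obtain u a where u: "u \<in> V" "norm u = 1" "f u = a *\<^sub>R u"
    using self_adjoint_eigenvector[OF f V(1-3)] .
  let ?W = "V \<inter> {x. f x = a *\<^sub>R x}"
  have "subspace {x. f x = a *\<^sub>R x}"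
    using f(1) by (auto simp: subspace_def linear_iff linear_0 algebra_simps)
  then have "subspace ?W"
    using V(1) by (rule subspace_inter[rotated])
  moreover have "u \<in> ?W" "u \<noteq> 0"
    using u by auto
  moreover have "g ` ?W \<subseteq> ?W"
    using V(4) comm g(1) by (auto simp: linear_scale)
  ultimately obtain v b where "v \<in> ?W" "norm v = 1" "g v = b *\<^sub>R v"
    using self_adjoint_eigenvector[OF g, of ?W] by (metis empty_iff insert_iff)
  then show thesis
    by (intro that) auto
qed

text \<open>Induction on the dimension: split off one joint eigenvector; by self-adjointness its
  orthogonal complement in \<open>V\<close> is again invariant under both maps.\<close>

lemma commuting_self_adjoint_eigenbasis:
  fixes f g :: "'a::euclidean_space \<Rightarrow> 'a"
  assumes f: "linear f" "\<And>x y. f x \<bullet> y = x \<bullet> f y"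
    and g: "linear g" "\<And>x y. g x \<bullet> y = x \<bullet> g y"
    and comm: "\<And>x. f (g x) = g (f x)"
    and V: "subspace V" "f ` V \<subseteq> V" "g ` V \<subseteq> V"
  shows "\<exists>S. pairwise orthogonal S \<and> (\<forall>w\<in>S. norm w = 1) \<and> span S = V \<and>
           (\<forall>w\<in>S. \<exists>a b. f w = a *\<^sub>R w \<and> g w = b *\<^sub>R w)"
  using V
proof (induction "dim V" arbitrary: V rule: less_induct)
  case less
  show ?case
  proof (cases "V = {0}")
    case True
    then show ?thesis
      by (intro exI[of _ "{}"]) auto
  next
    case False
    obtain v a b where v: "v \<in> V" "norm v = 1" "f v = a *\<^sub>R v" "g v = b *\<^sub>R v"
      using commuting_self_adjoint_eigenvector[OF f g comm less.prems(1) False less.prems(2,3)] .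
    have vv: "v \<bullet> v = 1"
      using v by (simp add: dot_square_norm)
    let ?W = "V \<inter> {x. x \<bullet> v = 0}"
    have W: "subspace ?W"
      using less.prems(1) by (intro subspace_inter) (auto simp: subspace_def algebra_simps)
    have "v \<notin> ?W"
      using vv by simp
    then have "?W \<subset> V"
      using v by blast
    then have "dim ?W < dim V"
      using W less.prems(1) by (intro dim_psubset) (simp add: span_eq_iff[THEN iffD2])
    moreover have "f ` ?W \<subseteq> ?W" "g ` ?W \<subseteq> ?W"
      using less.prems v f(2)[of _ v] g(2)[of _ v] by auto
    ultimately obtain S where S: "pairwise orthogonal S" "\<forall>w\<in>S. norm w = 1" "span S = ?W"
        "\<forall>w\<in>S. \<exists>a b. f w = a *\<^sub>R w \<and> g w = b *\<^sub>R w"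
      using less.hyps[OF _ W] by blast
    have SW: "S \<subseteq> ?W"
      using S(3) span_superset by blast
    have "pairwise orthogonal (insert v S)"
      using S(1) SW by (auto simp: pairwise_insert orthogonal_def inner_commute)
    moreover have "span (insert v S) = V"
    proof
      show "span (insert v S) \<subseteq> V"
        using SW v less.prems(1) by (intro span_minimal) auto
      show "V \<subseteq> span (insert v S)"
      proof
        fix x assume "x \<in> V"
        then have "x - (x \<bullet> v) *\<^sub>R v \<in> span S"
          unfolding S(3) using v vv less.prems(1)
          by (auto simp: inner_diff_left intro!: subspace_diff subspace_scale)
        then show "x \<in> span (insert v S)"
          by (auto simp: span_insert)
      qed
    qed
    ultimately show ?thesis
      using S v by (intro exI[of _ "insert v S"]) auto
  qed
qed

text \<open>Expanding \<open>e\<close> in a joint orthonormal eigenbasis turns its mixed moments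
  into sums over eigenvalue pairs with weights \<open>(e \<bullet> w)\<^sup>2\<close>. Cyclicity
  makes these weights nonzero and the pairs distinct.\<close>

lemma cyclic_vector_moments:
  fixes f g :: "'a::euclidean_space \<Rightarrow> 'a" and e :: 'a
  assumes f: "linear f" "\<And>x y. f x \<bullet> y = x \<bullet> f y"
    and g: "linear g" "\<And>x y. g x \<bullet> y = x \<bullet> g y"
    and comm: "\<And>x. f (g x) = g (f x)"
    and cyclic: "\<And>V. subspace V \<Longrightarrow> e \<in> V \<Longrightarrow> f ` V \<subseteq> V \<Longrightarrow> g ` V \<subseteq> V \<Longrightarrow> V = UNIV"
  shows "\<exists>x y \<rho> :: nat \<Rightarrow> real. inj_on (\<lambda>l. (x l, y l)) {1..DIM('a)} \<and>
    (\<forall>l\<in>{1..DIM('a)}. \<rho> l > 0) \<and>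
    (\<forall>i j. e \<bullet> (f ^^ i) ((g ^^ j) e) = (\<Sum>l=1..DIM('a). \<rho> l * x l ^ i * y l ^ j))"
proof -
  obtain S where S: "pairwise orthogonal S" "\<And>w. w \<in> S \<Longrightarrow> norm w = 1" "span S = UNIV"
      "\<forall>w\<in>S. \<exists>a b. f w = a *\<^sub>R w \<and> g w = b *\<^sub>R w"
    using commuting_self_adjoint_eigenbasis[OF f g comm, of UNIV] by auto
  obtain a b where ab: "\<And>w. w \<in> S \<Longrightarrow> f w = a w *\<^sub>R w" "\<And>w. w \<in> S \<Longrightarrow> g w = b w *\<^sub>R w"
    using S(4) by metis
  have "independent S"
    using S(1,2) by (intro pairwise_orthogonal_independent) force+
  then have fin: "finite S" and "card S = DIM('a)"
    using S(3) dim_eq_card[of S UNIV] by (auto simp: independent_imp_finite)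
  then obtain h where h: "bij_betw h {1..DIM('a)} S"
    using ex_bij_betw_nat_finite_1 by metis
  \<comment> \<open>The orthogonal complement of a joint eigenvector is invariant under both maps.
    If it contains \<open>e\<close>, it is the whole space and hence contains \<open>w\<close>
    itself.\<close>
  have eigen_0: "w = 0" if "f w = c *\<^sub>R w" "g w = d *\<^sub>R w" "e \<bullet> w = 0" for w c d
  proof -
    have "subspace {x. x \<bullet> w = 0}"
      by (auto simp: subspace_def algebra_simps)
    moreover have "f x \<bullet> w = c * (x \<bullet> w)" "g x \<bullet> w = d * (x \<bullet> w)" for x
      by (simp_all add: that f(2) g(2))
    ultimately have "{x. x \<bullet> w = 0} = UNIV"
      using \<open>e \<bullet> w = 0\<close> by (intro cyclic image_subsetI) simp_all
    then have "w \<in> {x. x \<bullet> w = 0}"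
      by (simp only: UNIV_I)
    then show ?thesis
      by simp
  qed
  have nz: "e \<bullet> w \<noteq> 0" if "w \<in> S" for w
    using eigen_0[OF ab[OF that]] S(2)[OF that] by auto
  have "inj_on (\<lambda>w. (a w, b w)) S"
  proof (rule inj_onI, rule ccontr)
    fix w w' assume w: "w \<in> S" "w' \<in> S" "(a w, b w) = (a w', b w')" "w \<noteq> w'"
    \<comment> \<open>If two basis vectors shared an eigenvalue pair, this combination, chosen
      orthogonal to \<open>e\<close>, would be a joint eigenvector too, and \<open>eigen_0\<close>
      would make it 0.\<close>
    let ?z = "(e \<bullet> w') *\<^sub>R w - (e \<bullet> w) *\<^sub>R w'"
    have "?z = 0"
    proof (rule eigen_0)
      show "f ?z = a w *\<^sub>R ?z" "g ?z = b w *\<^sub>R ?z"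
        using w ab f(1) g(1) by (simp_all add: linear_diff linear_scale algebra_simps)
    qed (simp add: inner_diff_right)
    moreover have "w \<bullet> w = 1" "w' \<bullet> w = 0"
      using w S(1,2) by (auto simp: pairwise_def orthogonal_def dot_square_norm)
    then have "?z \<bullet> w = e \<bullet> w'"
      by (simp add: inner_diff_left)
    ultimately show False
      using nz[OF w(2)] by simp
  qed
  then have "inj_on (\<lambda>l. (a (h l), b (h l))) {1..DIM('a)}"
    using h comp_inj_on[of h "{1..DIM('a)}" "\<lambda>w. (a w, b w)"] by (simp add: bij_betw_def o_def)
  moreover have "\<forall>l\<in>{1..DIM('a)}. (e \<bullet> h l)\<^sup>2 > 0"
    using h nz by (auto simp: bij_betw_def)
  moreover have "e \<bullet> (f ^^ i) ((g ^^ j) e) =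
      (\<Sum>l=1..DIM('a). (e \<bullet> h l)\<^sup>2 * a (h l) ^ i * b (h l) ^ j)" for i j
  proof -
    have 1: "(g ^^ j) x \<bullet> w = b w ^ j * (x \<bullet> w)" if "w \<in> S" for x w
      by (induction j) (simp_all add: g(2) ab[OF that])
    have 2: "(f ^^ i) x \<bullet> w = a w ^ i * (x \<bullet> w)" if "w \<in> S" for x w
      by (induction i) (simp_all add: f(2) ab[OF that])
    have e: "(\<Sum>w\<in>S. (e \<bullet> w) *\<^sub>R w) = e"
      using S fin by (intro orthonormal_basis_expand) auto
    have "e \<bullet> (f ^^ i) ((g ^^ j) e) =
        (\<Sum>w\<in>S. (e \<bullet> w) *\<^sub>R w) \<bullet> (f ^^ i) ((g ^^ j) e)"
      by (simp only: e)
    also have "\<dots> = (\<Sum>w\<in>S. (e \<bullet> w) * ((f ^^ i) ((g ^^ j) e) \<bullet> w))"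
      by (simp only: inner_sum_left inner_scaleR_left inner_commute[of "(f ^^ i) _"])
    also have "\<dots> = (\<Sum>w\<in>S. (e \<bullet> w)\<^sup>2 * a w ^ i * b w ^ j)"
      by (intro sum.cong) (simp_all add: 1 2 power2_eq_square mult_ac)
    finally show ?thesis
      by (simp only: sum.reindex_bij_betw[OF h, of "\<lambda>w. (e \<bullet> w)\<^sup>2 * a w ^ i * b w ^ j"])
  qed
  ultimately show ?thesis
    by (intro exI conjI allI)
qed

section \<open>The normalized sequence: commuting bordered matrices\<close>

lemma degree_le_3_cases:
  "{(i, j). i + j \<le> (3::nat)} =
    {(0, 0), (1, 0), (0, 1), (2, 0), (1, 1), (0, 2), (3, 0), (2, 1), (1, 2), (0, 3)}"
    (is "?L = ?R")
proof
  show "?L \<subseteq> ?R"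
  proof (rule subrelI)
    fix i j :: nat assume "(i, j) \<in> ?L"
    then have ij: "i + j \<le> 3"
      by simp
    then consider "i = 0" | "i = 1" | "i = 2" | "i = 3"
      by linarith
    then show "(i, j) \<in> ?R"
      using ij by cases (auto simp: eval_nat_numeral le_Suc_eq)
  qed
qed auto

text \<open>The commutator of the two \<open>3 \<times> 3\<close> blocks has entry \<open>k\<close>
  in row 2, column 3, its negative in the transposed place, and 0 elsewhere. The border columns
  contribute exactly the opposite. Their first entries are 0, so \<open>f\<close> and
  \<open>g\<close> map the first basis vector into the first three coordinates; moments of degree at
  most 3 therefore see only the original blocks.\<close>

lemma normalized_cubic_atoms:
  fixes m :: "nat \<Rightarrow> nat \<Rightarrow> real"
  assumes m: "m 0 0 = 1" "m 1 0 = 0" "m 0 1 = 0" "m 2 0 = 1" "m 1 1 = 0" "m 0 2 = 1"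
    and k: "k = (1 + m 3 0 * m 1 2 + m 2 1 * m 0 3) - ((m 2 1)\<^sup>2 + (m 1 2)\<^sup>2)" "k \<noteq> 0"
  shows "\<exists>x y \<rho> :: nat \<Rightarrow> real. inj_on (\<lambda>l. (x l, y l)) {1..4} \<and>
    (\<forall>l\<in>{1..4}. \<rho> l > 0) \<and>
    (\<forall>i j. i + j \<le> 3 \<longrightarrow> m i j = (\<Sum>l=1..4. \<rho> l * x l ^ i * y l ^ j))"
proof -
  define a0 a1 a2 a3 where a: "a0 = m 3 0" "a1 = m 2 1" "a2 = m 1 2" "a3 = m 0 3"
  \<comment> \<open>With border columns \<open>(0, 1, 0)\<close> and \<open>(0, 0, - k)\<close>, commutation forces the corners \<open>p\<close>, \<open>q\<close>.\<close>
  define p q where pq: "p = a2 * (1 + k) / k" "q = a1 * (1 + k)"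
  define f where "f = (\<lambda>(t, u, v, w).
    (u, t + a0 * u + a1 * v + w, a1 * u + a2 * v, u + p * w))"
  define g where "g = (\<lambda>(t, u, v, w).
    (v, a1 * u + a2 * v, t + a2 * u + a3 * v - k * w, - k * v + q * w))"
  have f: "linear f" "\<And>x y. f x \<bullet> y = x \<bullet> f y"
    by (auto simp: f_def linear_iff algebra_simps)
  have g: "linear g" "\<And>x y. g x \<bullet> y = x \<bullet> g y"
    by (auto simp: g_def linear_iff algebra_simps)
  \<comment> \<open>With the division removed, commutation is a list of polynomial
    identities.\<close>
  have pk: "p * k = a2 * (1 + k)"
    using k(2) by (simp add: pq)
  have comm: "f (g x) = g (f x)" for x
  proof (cases x)
    case (fields t u v w)
    show ?thesis
      using pk k(1) unfolding fields f_def g_def pq(2) a[symmetric]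
      by (simp add: power2_eq_square) (intro conjI, algebra+)
  qed
  let ?e = "(1, 0, 0, 0) :: real \<times> real \<times> real \<times> real"
  have cyclic: "V = UNIV" if V: "subspace V" "?e \<in> V" "f ` V \<subseteq> V" "g ` V \<subseteq> V" for V
  proof -
    have inV: "f z \<in> V" "g z \<in> V" if "z \<in> V" for z
      using V that by auto
    have 2: "(0, 1, 0, 0) \<in> V"
      using inV(1)[OF V(2)] by (simp add: f_def)
    have 3: "(0, 0, 1, 0) \<in> V"
      using inV(2)[OF V(2)] by (simp add: g_def)
    \<comment> \<open>The border entry 1 of \<open>f\<close> is what lets the orbit of
      \<open>?e\<close> reach the fourth coordinate.\<close>
    have "f (0, 1, 0, 0) - ?e - a0 *\<^sub>R (0, 1, 0, 0) - a1 *\<^sub>R (0, 0, 1, 0) \<in> V"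
      using V 2 3 inV by (intro subspace_diff subspace_scale)
    then have 4: "(0, 0, 0, 1) \<in> V"
      by (simp add: f_def)
    have "(t, u, v, w) \<in> V" for t u v w
    proof -
      have "t *\<^sub>R ?e + u *\<^sub>R (0, 1, 0, 0) + v *\<^sub>R (0, 0, 1, 0) + w *\<^sub>R (0, 0, 0, 1) \<in> V"
        using V 2 3 4 by (intro subspace_add subspace_scale)
      then show ?thesis
        by simp
    qed
    then show ?thesis
      by auto
  qed
  have dim: "DIM(real \<times> real \<times> real \<times> real) = 4"
    by simp
  note ex = cyclic_vector_moments[where f = f and g = g and e = ?e, OF f g comm, unfolded dim]
  obtain x y \<rho> :: "nat \<Rightarrow> real" where atoms: "inj_on (\<lambda>l. (x l, y l)) {1..4}"
    "\<forall>l\<in>{1..4}. \<rho> l > 0"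
    "\<forall>i j. ?e \<bullet> (f ^^ i) ((g ^^ j) ?e) = (\<Sum>l=1..4. \<rho> l * x l ^ i * y l ^ j)"
    by (rule ex[THEN exE], erule (3) cyclic) (elim exE conjE, rule that)
  have moments: "m i j = ?e \<bullet> (f ^^ i) ((g ^^ j) ?e)" if "i + j \<le> 3" for i j
  proof -
    have "(i, j) \<in> {(i, j). i + j \<le> 3}"
      using that by simp
    then show ?thesis
      unfolding degree_le_3_cases
      using m by (auto simp: f_def g_def a eval_nat_numeral)
  qed
  show ?thesis
    using atoms(1,2) by (intro exI conjI allI impI) (simp_all only: moments atoms(3))
qed

section \<open>The Riesz functional and affine changes of variables\<close>

lemma riesz_add: "riesz \<beta> (p + q) = riesz \<beta> p + riesz \<beta> q"
  by (simp add: riesz_def case_prod_unfold algebra_simps sum.distrib)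

lemma riesz_const_mult: "riesz \<beta> (const c * p) = c * riesz \<beta> p"
  by (simp add: riesz_def const_def case_prod_unfold sum_distrib_left mult_ac)

lemma coeff_monomial: "coeff (coeff (X ^ i * Y ^ j) j') i' = (if i' = i \<and> j' = j then 1 else 0)"
proof -
  have "X ^ i * Y ^ j = [:monom 1 i:] * monom 1 j"
    by (simp add: X_def Y_def poly_const_pow monom_altdef)
  then show ?thesis
    by auto
qed

lemma riesz_monomial:
  assumes "i + j \<le> 3"
  shows "riesz \<beta> (X ^ i * Y ^ j) = \<beta> i j"
proof -
  have fin: "finite {(i, j). i + j \<le> (3::nat)}"
    unfolding degree_le_3_cases by simp
  have "riesz \<beta> (X ^ i * Y ^ j) =
      (\<Sum>z\<in>{(i, j). i + j \<le> 3}. if z = (i, j) then \<beta> i j else 0)"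
    unfolding riesz_def by (intro sum.cong) (auto simp: coeff_monomial split: if_splits)
  also have "\<dots> = \<beta> i j"
    using assms by (simp add: sum.delta[OF fin])
  finally show ?thesis .
qed

lemma riesz_affine_mult:
  "riesz \<beta> ((const a + const b * X + const c * Y) * (const a' + const b' * X + const c' * Y)) =
    a * a' * \<beta> 0 0 + (a * b' + b * a') * \<beta> 1 0 + (a * c' + c * a') * \<beta> 0 1 +
    b * b' * \<beta> 2 0 + (b * c' + c * b') * \<beta> 1 1 + c * c' * \<beta> 0 2"
  unfolding riesz_def degree_le_3_cases
  by (simp add: X_def Y_def const_def eval_nat_numeral algebra_simps)

lemma const_simps:
  "const 0 = 0" "const 1 = 1"
  by (simp_all add: const_def one_pCons)

text \<open>A monomial in \<open>X\<close> and \<open>Y\<close> expands into monomials in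
  \<open>P\<close> and \<open>Q\<close> of no larger degree, and \<open>F\<close> kills those. This
  transfers moment identities from the normalized variables to the original ones.\<close>

lemma affine_generators_annihilate:
  fixes F :: "bipoly \<Rightarrow> real"
  assumes add: "\<And>p q. F (p + q) = F p + F q" and mult: "\<And>c p. F (const c * p) = c * F p"
    and PQ: "\<And>i j. i + j \<le> n \<Longrightarrow> F (P ^ i * Q ^ j) = 0"
    and X: "X = const a + const b * P + const c * Q"
    and Y: "Y = const a' + const b' * P + const c' * Q"
    and "i + j \<le> n"
  shows "F (X ^ i * Y ^ j) = 0"
proof -
  \<comment> \<open>\<open>Z m p\<close> records that, as far as \<open>F\<close> can tell,
    \<open>p\<close> behaves like a polynomial of degree at most \<open>m\<close> in
    \<open>P\<close> and \<open>Q\<close>. Multiplication by an affine form costs one degree, so no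
    expansion of powers is needed.\<close>
  define Z where "Z m p \<longleftrightarrow> (\<forall>i j. i + j + m \<le> n \<longrightarrow> F (p * (P ^ i * Q ^ j)) = 0)" for m p
  have step: "Z (Suc m) ((const a + const b * P + const c * Q) * p)" if "Z m p" for m p a b c
    unfolding Z_def
  proof (intro allI impI)
    fix i j assume ij: "i + j + Suc m \<le> n"
    have "(const a + const b * P + const c * Q) * p * (P ^ i * Q ^ j) =
        const a * (p * (P ^ i * Q ^ j)) + const b * (p * (P ^ Suc i * Q ^ j)) +
        const c * (p * (P ^ i * Q ^ Suc j))"
      by (simp add: algebra_simps)
    moreover have "F (p * (P ^ i * Q ^ j)) = 0" "F (p * (P ^ Suc i * Q ^ j)) = 0"
        "F (p * (P ^ i * Q ^ Suc j)) = 0"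
      using that ij unfolding Z_def by (auto simp del: power_Suc)
    ultimately show "F ((const a + const b * P + const c * Q) * p * (P ^ i * Q ^ j)) = 0"
      by (simp only: add mult)
  qed
  have "Z j (Y ^ j)"
  proof (induction j)
    case 0
    then show ?case by (simp add: Z_def PQ)
  next
    case (Suc j)
    then show ?case using step[OF Suc, of a' b' c'] by (simp add: Y[symmetric])
  qed
  then have "Z (i + j) (X ^ i * Y ^ j)"
  proof (induction i)
    case 0
    then show ?case by simp
  next
    case (Suc i)
    then show ?case using step[of "i + j" "X ^ i * Y ^ j" a b c]
      by (simp add: X[symmetric] mult.assoc)
  qed
  then show ?thesis
    using \<open>i + j \<le> n\<close> unfolding Z_def by (metis add.commute add_0_right mult_1_right power_0)
qed

text \<open>The expression is the Riesz functional applied to the square of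
  \<open>a + b x + c y\<close>. In this scalar form positivity passes directly to the sequence
  divided by \<open>\<beta> 0 0\<close>.\<close>

lemma positive_definite_moment_matrix1:
  assumes "positive_definite (moment_matrix1 \<beta>)" and "(a, b, c) \<noteq> (0, 0, 0)"
  shows "a\<^sup>2 * \<beta> 0 0 + 2 * a * b * \<beta> 1 0 + 2 * a * c * \<beta> 0 1 +
    b\<^sup>2 * \<beta> 2 0 + 2 * b * c * \<beta> 1 1 + c\<^sup>2 * \<beta> 0 2 > 0"
proof -
  let ?v = "vector [a, b, c] :: real ^ 3"
  have "?v \<noteq> 0"
    using assms(2) by (auto simp: vec_eq_iff forall_3)
  then have "?v \<bullet> (moment_matrix1 \<beta> *v ?v) > 0"
    using assms(1) by (simp add: positive_definite_def)
  then show ?thesis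
    by (simp add: moment_matrix1_def matrix_vector_mult_def inner_vec_def sum_3
        power2_eq_square algebra_simps)
qed

lemma d3_eq:
  assumes "\<gamma> 0 0 = 1"
  shows "d3 \<gamma> = - \<gamma> 0 2 * (\<gamma> 1 0)\<^sup>2 + 2 * \<gamma> 0 1 * \<gamma> 1 0 * \<gamma> 1 1 - (\<gamma> 1 1)\<^sup>2
    - (\<gamma> 0 1)\<^sup>2 * \<gamma> 2 0 + \<gamma> 0 2 * \<gamma> 2 0"
  using assms by (simp add: d3_def moment_matrix1_def det_3 power2_eq_square algebra_simps)

section \<open>The normalizing affine map and its inverse, for total mass 1\<close>

context
  fixes \<gamma> :: "nat \<Rightarrow> nat \<Rightarrow> real"
  assumes \<gamma>_0: "\<gamma> 0 0 = 1"
    and \<gamma>_pos: "\<And>a b c. (a, b, c) \<noteq> (0, 0, 0) \<Longrightarrow>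
      a\<^sup>2 * \<gamma> 0 0 + 2 * a * b * \<gamma> 1 0 + 2 * a * c * \<gamma> 0 1 +
      b\<^sup>2 * \<gamma> 2 0 + 2 * b * c * \<gamma> 1 1 + c\<^sup>2 * \<gamma> 0 2 > 0"
begin

text \<open>\<open>d2 \<gamma>\<close> is the variance of \<open>x\<close>, the value of the form at
  \<open>x - \<gamma> 1 0\<close>.\<close>

lemma d2_pos: "d2 \<gamma> > 0"
  using \<gamma>_pos[of "- \<gamma> 1 0" 1 0] \<gamma>_0 by (simp add: d2_def power2_eq_square)

lemma d3_pos: "d3 \<gamma> > 0"
proof -
  \<comment> \<open>Evaluate the quadratic form at the last column of the adjugate of the moment matrix.\<close>
  have "0 < d2 \<gamma> * d3 \<gamma>"
    using \<gamma>_pos[of "\<gamma> 1 0 * \<gamma> 1 1 - \<gamma> 0 1 * \<gamma> 2 0" "\<gamma> 0 1 * \<gamma> 1 0 - \<gamma> 1 1" "d2 \<gamma>"] d2_pos \<gamma>_0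
    by (simp add: d3_eq d2_def power2_eq_square algebra_simps)
  then show ?thesis
    using d2_pos by (simp add: zero_less_mult_iff)
qed

text \<open>Gram-Schmidt applied to \<open>1, x, y\<close> for the form (p, q) \<mapsto>
  \<open>riesz \<gamma> (p * q)\<close> gives \<open>1\<close>, \<open>Psi2 \<gamma>\<close> and
  \<open>- Psi1 \<gamma>\<close>. The change of variables is triangular, and the last two equations
  invert it. The zero coefficients give each equation the shape expected by
  \<open>riesz_affine_mult\<close> or \<open>affine_generators_annihilate\<close>.\<close>

lemma Psi_affine:
  defines "s \<equiv> sqrt (d2 \<gamma> * d3 \<gamma>)" and "r \<equiv> sqrt (d2 \<gamma>)"
  shows "Psi1 \<gamma> = const ((\<gamma> 0 1 * \<gamma> 2 0 - \<gamma> 1 0 * \<gamma> 1 1) / s)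
      + const ((\<gamma> 1 1 - \<gamma> 0 1 * \<gamma> 1 0) / s) * X + const (- d2 \<gamma> / s) * Y" (is ?thesis1)
    and "Psi2 \<gamma> = const (- \<gamma> 1 0 / r) + const (1 / r) * X + const 0 * Y" (is ?thesis2)
    and "X = const (\<gamma> 1 0) + const 0 * Psi1 \<gamma> + const r * Psi2 \<gamma>" (is ?thesis3)
    and "Y = const (\<gamma> 0 1) + const (- s / d2 \<gamma>) * Psi1 \<gamma>
      + const ((\<gamma> 1 1 - \<gamma> 0 1 * \<gamma> 1 0) / r) * Psi2 \<gamma>" (is ?thesis4)
proof -
  have s: "s > 0" and r: "r > 0" "r\<^sup>2 = d2 \<gamma>"
    using d2_pos d3_pos by (simp_all add: s_def r_def)
  have \<gamma>_20: "\<gamma> 2 0 = r\<^sup>2 + (\<gamma> 1 0)\<^sup>2"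
    by (simp add: r(2) d2_def)
  have "sqrt (d2 \<gamma> / d3 \<gamma>) = d2 \<gamma> / s"
    using d2_pos d3_pos by (simp add: s_def real_sqrt_mult real_sqrt_divide field_simps)
  then show 1: ?thesis1
    by (simp add: Psi1_def const_def s_def X_def Y_def)
  show 2: ?thesis2
    by (simp add: Psi2_def const_def r_def X_def Y_def)
  show ?thesis3
    unfolding 2 using r by (simp add: const_def X_def Y_def)
  show ?thesis4
    unfolding 1 2 using r(1) s \<gamma>_20
    by (simp add: const_def X_def Y_def r(2)[symmetric] power2_eq_square field_simps)
qed

text \<open>This is the orthonormality produced by Gram-Schmidt. The trivial powers are kept so that
  each left side folds to a normalized moment \<open>m i j\<close>.\<close>

lemma normalized_moments:
  "riesz \<gamma> (Psi1 \<gamma> ^ 0 * Psi2 \<gamma> ^ 0) = 1" "riesz \<gamma> (Psi1 \<gamma> ^ 1 * Psi2 \<gamma> ^ 0) = 0"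
  "riesz \<gamma> (Psi1 \<gamma> ^ 0 * Psi2 \<gamma> ^ 1) = 0" "riesz \<gamma> (Psi1 \<gamma> ^ 2 * Psi2 \<gamma> ^ 0) = 1"
  "riesz \<gamma> (Psi1 \<gamma> ^ 1 * Psi2 \<gamma> ^ 1) = 0" "riesz \<gamma> (Psi1 \<gamma> ^ 0 * Psi2 \<gamma> ^ 2) = 1"
proof -
  define s r where "s = sqrt (d2 \<gamma> * d3 \<gamma>)" "r = sqrt (d2 \<gamma>)"
  note sr_def = this
  have s: "s > 0" "s\<^sup>2 = d2 \<gamma> * d3 \<gamma>" and r: "r > 0" "r\<^sup>2 = d2 \<gamma>"
    using d2_pos d3_pos by (simp_all add: sr_def)
  note Psi = Psi_affine(1,2)[folded sr_def]
  \<comment> \<open>First moments come from the product formula with the constant 1 as second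
    factor.\<close>
  have aff: "riesz \<gamma> (const a + const b * X + const c * Y) = a + b * \<gamma> 1 0 + c * \<gamma> 0 1" for a b c
    using riesz_affine_mult[of \<gamma> a b c 1 0 0] by (simp add: const_simps \<gamma>_0)
  show "riesz \<gamma> (Psi1 \<gamma> ^ 0 * Psi2 \<gamma> ^ 0) = 1"
    using aff[of 1 0 0] by (simp add: const_simps)
  show "riesz \<gamma> (Psi1 \<gamma> ^ 1 * Psi2 \<gamma> ^ 0) = 0"
    using s(1) unfolding power_one_right power_0 mult_1_right Psi aff
    by (simp add: d2_def field_simps power2_eq_square)
  show "riesz \<gamma> (Psi1 \<gamma> ^ 0 * Psi2 \<gamma> ^ 1) = 0"
    using r(1) unfolding power_one_right power_0 mult_1_left Psi aff by simp
  have "s\<^sup>2 * riesz \<gamma> (Psi1 \<gamma> * Psi1 \<gamma>) = d2 \<gamma> * d3 \<gamma>"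
    using s(1) unfolding Psi riesz_affine_mult d3_eq[where \<gamma> = \<gamma>, OF \<gamma>_0] \<gamma>_0
    by (simp add: field_simps power2_eq_square d2_def)
  then show "riesz \<gamma> (Psi1 \<gamma> ^ 2 * Psi2 \<gamma> ^ 0) = 1"
    using s d2_pos d3_pos by (simp add: power2_eq_square)
  show "riesz \<gamma> (Psi1 \<gamma> ^ 1 * Psi2 \<gamma> ^ 1) = 0"
    using s(1) r(1) unfolding Psi power_one_right riesz_affine_mult \<gamma>_0
    by (simp add: field_simps power2_eq_square d2_def)
  have "r\<^sup>2 * riesz \<gamma> (Psi2 \<gamma> * Psi2 \<gamma>) = d2 \<gamma>"
    using r(1) unfolding Psi riesz_affine_mult \<gamma>_0
    by (simp add: field_simps power2_eq_square d2_def)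
  then show "riesz \<gamma> (Psi1 \<gamma> ^ 0 * Psi2 \<gamma> ^ 2) = 1"
    using r d2_pos by (simp add: power2_eq_square)
qed

text \<open>The inverse affine map carries the atoms back with unchanged weights. The Riesz
  functional minus the weighted sum of evaluations at the new atoms vanishes on monomials in
  \<open>Psi1 \<gamma>\<close> and \<open>Psi2 \<gamma>\<close>, hence on those in \<open>X\<close>
  and \<open>Y\<close>.\<close>

lemma atoms_from_normalization:
  fixes x y \<rho> :: "'i \<Rightarrow> real"
  assumes I: "finite I" "inj_on (\<lambda>l. (x l, y l)) I"
    and mom: "\<And>i j. i + j \<le> 3 \<Longrightarrow>
      riesz \<gamma> (Psi1 \<gamma> ^ i * Psi2 \<gamma> ^ j) = (\<Sum>l\<in>I. \<rho> l * x l ^ i * y l ^ j)"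
  obtains x' y' :: "'i \<Rightarrow> real" where "inj_on (\<lambda>l. (x' l, y' l)) I"
    "\<And>i j. i + j \<le> 3 \<Longrightarrow> \<gamma> i j = (\<Sum>l\<in>I. \<rho> l * x' l ^ i * y' l ^ j)"
proof -
  define s r where "s = sqrt (d2 \<gamma> * d3 \<gamma>)" "r = sqrt (d2 \<gamma>)"
  note sr_def = this
  have s: "s > 0" and r: "r > 0" "r\<^sup>2 = d2 \<gamma>"
    using d2_pos d3_pos by (simp_all add: sr_def)
  note Psi = Psi_affine[folded sr_def]
  \<comment> \<open>These are the formulas for \<open>X\<close> and \<open>Y\<close> in
    \<open>Psi_affine\<close>, with \<open>x l\<close> and \<open>y l\<close> in place of
    \<open>Psi1 \<gamma>\<close> and \<open>Psi2 \<gamma>\<close>.\<close>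
  define x' where "x' l = \<gamma> 1 0 + r * y l" for l
  define y' where "y' l = \<gamma> 0 1 - s / d2 \<gamma> * x l + (\<gamma> 1 1 - \<gamma> 0 1 * \<gamma> 1 0) / r * y l" for l
  define ev where "ev l p = poly (poly p [:y' l:]) (x' l)" for l and p :: bipoly
  have ev: "ev l (p + q) = ev l p + ev l q" "ev l (p * q) = ev l p * ev l q"
    "ev l (p ^ n) = ev l p ^ n" "ev l (const c) = c" "ev l X = x' l" "ev l Y = y' l" for l p q n c
    by (simp_all add: ev_def const_def X_def Y_def)
  \<comment> \<open>Evaluating the inverse formulas at the new atom recovers the old coordinates,
    \<open>Psi2\<close> first because the formula for \<open>X\<close> involves it alone.\<close>
  have ev2: "ev l (Psi2 \<gamma>) = y l" for l
    using arg_cong[OF Psi(3), of "ev l"] r(1) by (simp add: ev x'_def)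
  have ev1: "ev l (Psi1 \<gamma>) = x l" for l
    using arg_cong[OF Psi(4), of "ev l"] s d2_pos by (simp add: ev y'_def ev2)
  define F where "F p = riesz \<gamma> p - (\<Sum>l\<in>I. \<rho> l * ev l p)" for p
  have F: "F (p + q) = F p + F q" "F (const c * p) = c * F p" for p q c
    by (simp_all add: F_def riesz_add riesz_const_mult ev distrib_left sum.distrib
        right_diff_distrib sum_distrib_left mult.left_commute)
  have "F (X ^ i * Y ^ j) = 0" if "i + j \<le> 3" for i j
    by (rule affine_generators_annihilate[OF F _ Psi(3,4) that])
      (simp add: F_def mom ev ev1 ev2 mult.assoc)
  then have "\<gamma> i j = (\<Sum>l\<in>I. \<rho> l * x' l ^ i * y' l ^ j)" if "i + j \<le> 3" for i j
    using that by (simp add: F_def riesz_monomial ev mult.assoc)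
  moreover have "inj_on (\<lambda>l. (x' l, y' l)) I"
    using I(2) r(1) s d2_pos by (auto simp: inj_on_def x'_def y'_def)
  ultimately show thesis
    by (rule that[rotated])
qed

end

section \<open>Finitely atomic measures and the return to arbitrary total mass\<close>

text \<open>The measure is the image under \<open>l \<mapsto> (x l, y l)\<close> of the weighted
  counting measure on the index set, so integrals are finite sums.\<close>

lemma finitely_atomic_measure:
  fixes x y \<rho> :: "'i \<Rightarrow> real"
  assumes I: "finite I" "inj_on (\<lambda>l. (x l, y l)) I" and pos: "\<And>l. l \<in> I \<Longrightarrow> \<rho> l > 0"
    and mom: "\<And>i j. i + j \<le> 3 \<Longrightarrow> \<beta> i j = (\<Sum>l\<in>I. \<rho> l * x l ^ i * y l ^ j)"
  shows "\<exists>\<mu>. representing_measure \<beta> \<mu> \<and> atomic (card I) \<mu>"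
proof -
  define z where "z = (\<lambda>l. (x l, y l))"
  let ?P = "point_measure I (\<lambda>l. ennreal (\<rho> l))"
  define \<mu> where "\<mu> = distr ?P borel z"
  have z[measurable]: "z \<in> measurable ?P borel"
    by simp
  have int: "integrable ?P h" for h :: "'i \<Rightarrow> real"
    unfolding point_measure_def using I(1) pos
    by (subst integrable_density) (auto simp: integrable_count_space AE_count_space less_imp_le)
  have rep: "representing_measure \<beta> \<mu>"
    unfolding representing_measure_def
  proof (intro conjI allI impI)
    show "sets \<mu> = sets borel"
      by (simp add: \<mu>_def)
    fix i j :: nat assume ij: "i + j \<le> 3"
    let ?h = "\<lambda>(x, y). x ^ i * y ^ j :: real"
    have h: "?h \<in> borel_measurable borel"
      by (intro borel_measurable_continuous_onI)
        (auto simp: case_prod_unfold intro!: continuous_intros)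
    show "integrable \<mu> ?h"
      unfolding \<mu>_def using h z int by (simp add: integrable_distr_eq)
    have "(\<integral>w. ?h w \<partial>\<mu>) = (\<integral>l. ?h (z l) \<partial>?P)"
      unfolding \<mu>_def using h z by (rule integral_distr[rotated])
    also have "\<dots> = (\<Sum>l\<in>I. \<rho> l *\<^sub>R ?h (z l))"
      using I(1) pos by (intro lebesgue_integral_point_measure_finite) (auto simp: less_imp_le)
    also have "\<dots> = \<beta> i j"
      using ij by (simp add: mom z_def mult.assoc)
    finally show "\<beta> i j = (\<integral>w. ?h w \<partial>\<mu>)" ..
  qed
  \<comment> \<open>The mass of an open set is the sum of the positive weights of the atoms in
    it.\<close>
  have "emeasure \<mu> U > 0 \<longleftrightarrow> U \<inter> z ` I \<noteq> {}" if "open U" for U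
  proof -
    have "emeasure \<mu> U = (\<Sum>l\<in>z -` U \<inter> I. ennreal (\<rho> l))"
      unfolding \<mu>_def using that I(1)
      by (subst emeasure_distr[OF z]) (simp_all add: space_point_measure emeasure_point_measure_finite)
    moreover have "(\<Sum>l\<in>z -` U \<inter> I. ennreal (\<rho> l)) = 0 \<longleftrightarrow> (\<forall>l\<in>z -` U \<inter> I. ennreal (\<rho> l) = 0)"
      using I(1) by (intro sum_eq_0_iff) auto
    moreover have "ennreal (\<rho> l) \<noteq> 0" if "l \<in> I" for l
      using pos[OF that] by simp
    ultimately show ?thesis
      unfolding zero_less_iff_neq_zero by auto
  qed
  then have "measure_support \<mu> = {w. \<forall>U. open U \<and> w \<in> U \<longrightarrow> U \<inter> z ` I \<noteq> {}}"
    by (auto simp: measure_support_def)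
  also have "\<dots> = z ` I"
  proof (intro equalityI subsetI)
    fix w assume "w \<in> {w. \<forall>U. open U \<and> w \<in> U \<longrightarrow> U \<inter> z ` I \<noteq> {}}"
    \<comment> \<open>A finite set is closed, so its complement would be a neighbourhood of
      \<open>w\<close> without atoms.\<close>
    then have "open (- z ` I) \<and> w \<in> - z ` I \<longrightarrow> - z ` I \<inter> z ` I \<noteq> {}"
      unfolding mem_Collect_eq by (rule spec)
    moreover have "open (- z ` I)"
      using I(1) by (intro open_Compl finite_imp_closed) simp
    ultimately show "w \<in> z ` I"
      by simp
  qed auto
  finally have "atomic (card I) \<mu>"
    using I by (simp add: atomic_def card_image z_def)
  with rep show ?thesis
    by blast
qed

theorem theorem3p2:
  fixes \<beta> :: "nat \<Rightarrow> nat \<Rightarrow> real" and a0 a1 a2 a3 k :: real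
  assumes "cubic_moment_sequence \<beta>" and "nonsingular \<beta>"
    and "a0 = cubic_moment \<beta> 0" and "a1 = cubic_moment \<beta> 1"
    and "a2 = cubic_moment \<beta> 2" and "a3 = cubic_moment \<beta> 3"
    and "k = (1 + a0 * a2 + a1 * a3) - (a1\<^sup>2 + a2\<^sup>2)"
    and "k \<noteq> 0"
  shows "(\<exists>\<mu>. representing_measure \<beta> \<mu> \<and> atomic 4 \<mu>) \<and>
    (\<exists>x y \<rho> :: nat \<Rightarrow> real.
       inj_on (\<lambda>l. (x l, y l)) {1..4} \<and> (\<forall>l\<in>{1..4}. \<rho> l > 0) \<and>
       (\<forall>i j. i + j \<le> 3 \<longrightarrow> \<beta> i j = (\<Sum>l=1..4. \<rho> l * x l ^ i * y l ^ j)))"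
proof -
  define \<gamma> where "\<gamma> = (\<lambda>i j. \<beta> i j / \<beta> 0 0)"
  have pos: "\<beta> 0 0 > 0"
    using assms(1) by (simp add: cubic_moment_sequence_def)
  have \<gamma>_0: "\<gamma> 0 0 = 1"
    using pos by (simp add: \<gamma>_def)
  have \<gamma>_pos: "a\<^sup>2 * \<gamma> 0 0 + 2 * a * b * \<gamma> 1 0 + 2 * a * c * \<gamma> 0 1 +
      b\<^sup>2 * \<gamma> 2 0 + 2 * b * c * \<gamma> 1 1 + c\<^sup>2 * \<gamma> 0 2 > 0" if "(a, b, c) \<noteq> (0, 0, 0)" for a b c
  proof -
    have "0 < (a\<^sup>2 * \<beta> 0 0 + 2 * a * b * \<beta> 1 0 + 2 * a * c * \<beta> 0 1 +
        b\<^sup>2 * \<beta> 2 0 + 2 * b * c * \<beta> 1 1 + c\<^sup>2 * \<beta> 0 2) / \<beta> 0 0"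
      using positive_definite_moment_matrix1[OF _ that] assms(2) pos
      by (simp only: nonsingular_def divide_pos_pos)
    then show ?thesis
      using pos by (simp add: \<gamma>_def add_divide_distrib)
  qed
  define m where "m = normalization \<beta>"
  have m: "m i j = riesz \<gamma> (Psi1 \<gamma> ^ i * Psi2 \<gamma> ^ j)" for i j
    by (simp add: m_def normalization_def \<gamma>_def Let_def)
  have a: "a0 = m 3 0" "a1 = m 2 1" "a2 = m 1 2" "a3 = m 0 3"
    using assms(3-6) by (simp_all add: cubic_moment_def m_def)
  obtain x y \<rho> :: "nat \<Rightarrow> real" where atoms: "inj_on (\<lambda>l. (x l, y l)) {1..4}"
      "\<forall>l\<in>{1..4}. \<rho> l > 0"
      "\<forall>i j. i + j \<le> 3 \<longrightarrow> m i j = (\<Sum>l=1..4. \<rho> l * x l ^ i * y l ^ j)"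
    using normalized_cubic_atoms[of m k] normalized_moments[OF \<gamma>_0 \<gamma>_pos, folded m]
      assms(7,8) a by blast
  obtain x' y' where atoms': "inj_on (\<lambda>l. (x' l, y' l)) {1..4::nat}"
      "\<And>i j. i + j \<le> 3 \<Longrightarrow> \<gamma> i j = (\<Sum>l=1..4. \<rho> l * x' l ^ i * y' l ^ j)"
    using atoms_from_normalization[OF \<gamma>_0 \<gamma>_pos, of "{1..4}" x y \<rho>] atoms(1,3)
    by (auto simp: m)
  \<comment> \<open>Multiplying the weights by \<open>\<beta> 0 0\<close> undoes the division that
    made the total mass 1.\<close>
  have \<rho>: "\<beta> 0 0 * \<rho> l > 0" if "l \<in> {1..4}" for l
    using atoms(2) that pos by simp
  have mom: "\<beta> i j = (\<Sum>l=1..4. \<beta> 0 0 * \<rho> l * x' l ^ i * y' l ^ j)" if "i + j \<le> 3" for i j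
  proof -
    have "\<beta> i j = \<beta> 0 0 * \<gamma> i j"
      using pos by (simp add: \<gamma>_def)
    then show ?thesis
      by (simp add: atoms'(2)[OF that] sum_distrib_left mult.assoc)
  qed
  have "\<exists>\<mu>. representing_measure \<beta> \<mu> \<and> atomic (card {1..4::nat}) \<mu>"
    by (rule finitely_atomic_measure[OF _ atoms'(1) \<rho> mom]) simp
  then have "\<exists>\<mu>. representing_measure \<beta> \<mu> \<and> atomic 4 \<mu>"
    by simp
  moreover have "\<forall>l\<in>{1..4}. \<beta> 0 0 * \<rho> l > 0"
    using \<rho> by blast
  moreover have "\<forall>i j. i + j \<le> 3 \<longrightarrow>
      \<beta> i j = (\<Sum>l=1..4. \<beta> 0 0 * \<rho> l * x' l ^ i * y' l ^ j)"
    using mom by blast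
  ultimately show ?thesis
    using atoms'(1)
    by (intro conjI exI[of _ x'] exI[of _ y'] exI[of _ "\<lambda>l. \<beta> 0 0 * \<rho> l"])
qed

end
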